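(* Let $V$ be a nonzero finite dimensional $U_q(\widehat{\mathfrak{sl}}_2)$-module (not necessarily irreducible) on which the actions of $K_0$ and $K_1$ are diagonalizable. For $\epsilon_0,\epsilon_1\in\{1,-1\}$ let $$V_{even}^{(\epsilon_0,\epsilon_1)}=\mathrm{span}\{v\in V\mid K_0v=\epsilon_0q^iv,\ K_1v=\epsilon_1q^{-i}v,\ i\in\mathbb{Z},\ i\text{ even}\},$$ $$V_{odd}^{(\epsilon_0,\epsilon_1)}=\mathrm{span}\{v\in V\mid K_0v=\epsilon_0q^iv,\ K_1v=\epsilon_1q^{-i}v,\ i\in\mathbb{Z},\ i\text{ odd}\}.$$ Then $$V=\sum_{(\epsilon_0,\epsilon_1)}\sum_{\sigma}V_\sigma^{(\epsilon_0,\epsilon_1)}\qquad\text{(direct sum of }U_q(\widehat{\mathfrak{sl}}_2)\text{-modules)},$$ where the first sum is over all ordered pairs $(\epsilon_0,\epsilon_1)$ with $\epsilon_0,\epsilon_1\in\{1,-1\}$ and the second is over $\sigma\in\{even,odd\}$.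
   Context: $\mathbb{K}$ is an algebraically closed field and $q\in\mathbb{K}$ is a fixed nonzero scalar that is not a root of unity. Write $[n]=\frac{q^n-q^{-n}}{q-q^{-1}}$ for $n=0,1,\ldots$. If the characteristic of $\mathbb{K}$ is $2$, the set $\{1,-1\}$ is viewed as having a single element. The quantum affine algebra $U_q(\widehat{\mathfrak{sl}}_2)$ is the unital associative $\mathbb{K}$-algebra with generators (the Chevalley generators) $e_i^{\pm}$, $K_i^{\pm1}$, $i\in\{0,1\}$, and relations: $K_iK_i^{-1}=K_i^{-1}K_i=1$; $K_0K_1=K_1K_0$; $K_ie_i^{\pm}K_i^{-1}=q^{\pm2}e_i^{\pm}$; $K_ie_j^{\pm}K_i^{-1}=q^{\mp2}e_j^{\pm}$ for $i\ne j$; $e_i^+e_i^--e_i^-e_i^+=\frac{K_i-K_i^{-1}}{q-q^{-1}}$; $e_0^{\pm}e_1^{\mp}=e_1^{\mp}e_0^{\pm}$; and $(e_i^{\pm})^3e_j^{\pm}-[3](e_i^{\pm})^2e_j^{\pm}e_i^{\pm}+[3]e_i^{\pm}e_j^{\pm}(e_i^{\pm})^2-e_j^{\pm}(e_i^{\pm})^3=0$ for $i\neq j$. *)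

theory Defs
  imports
    "HOL-Library.Poly_Mapping"
    "HOL-Library.FuncSet"
    "HOL-Computational_Algebra.Polynomial"
    "HOL-Algebra.QuotRing"
begin

section \<open>The free algebra on the Chevalley generators\<close>

datatype node = Node0 | Node1

datatype sign = Plus | Minus

text \<open>\<open>Chev_E i s\<close> is $e_i^{s}$; \<open>Chev_Kinv i\<close> is a separate formal symbol for $K_i^{-1}$.\<close>

datatype chevalley = Chev_E node sign | Chev_K node | Chev_Kinv node

text \<open>
  Words form a monoid under concatenation, written additively, so that the convolution
  product on \<open>word \<Rightarrow>\<^sub>0 'k\<close> is the product of the free unital associative algebra.
\<close>

datatype word = Word (letters: "chevalley list")

instantiation word :: monoid_add
begin

definition zero_word :: word where "zero_word = Word []"

definition plus_word :: "word \<Rightarrow> word \<Rightarrow> word" where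
  "plus_word u w = Word (letters u @ letters w)"

instance
  by standard (auto simp: zero_word_def plus_word_def)

end

type_synonym 'k free_alg = "word \<Rightarrow>\<^sub>0 'k"

definition const :: "'k::field \<Rightarrow> 'k free_alg" where
  "const c = Poly_Mapping.single 0 c"

definition gen :: "chevalley \<Rightarrow> 'k::field free_alg" where
  "gen x = Poly_Mapping.single (Word [x]) 1"

definition free_ring :: "('k::field free_alg) ring" where
  "free_ring = \<lparr>carrier = UNIV, mult = (*), one = 1, zero = 0, add = (+)\<rparr>"

lemma ring_free_ring: "ring (free_ring :: ('k::field free_alg) ring)"
proof (rule ringI)
  show "abelian_group (free_ring :: ('k free_alg) ring)"
  proof (rule abelian_groupI)
    fix x :: "'k free_alg"
    show "\<exists>y\<in>carrier free_ring. y \<oplus>\<^bsub>free_ring\<^esub> x = \<zero>\<^bsub>free_ring\<^esub>"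
      by (rule bexI[of _ "- x"]) (simp_all add: free_ring_def)
  qed (simp_all add: free_ring_def algebra_simps)
  show "Group.monoid (free_ring :: ('k free_alg) ring)"
    by (rule monoidI) (simp_all add: free_ring_def algebra_simps)
qed (simp_all add: free_ring_def algebra_simps)


section \<open>The quantum affine algebra of type \<open>A\<^sub>1\<^sup>(\<^sup>1\<^sup>)\<close>\<close>

definition qint :: "'k::field \<Rightarrow> nat \<Rightarrow> 'k" where
  "qint q n = (q ^ n - inverse q ^ n) / (q - inverse q)"

fun sign_int :: "sign \<Rightarrow> int" where
  "sign_int Plus = 1"
| "sign_int Minus = -1"

fun opposite :: "sign \<Rightarrow> sign" where
  "opposite Plus = Minus"
| "opposite Minus = Plus"

text \<open>Each relation $l = r$ is recorded as the element $l - r$ of the free algebra.\<close>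

inductive_set Uq_relations :: "'k::field \<Rightarrow> 'k free_alg set" for q :: 'k where
  K_Kinv:
    "gen (Chev_K i) * gen (Chev_Kinv i) - 1 \<in> Uq_relations q"
| Kinv_K:
    "gen (Chev_Kinv i) * gen (Chev_K i) - 1 \<in> Uq_relations q"
| K_commute:
    "gen (Chev_K Node0) * gen (Chev_K Node1) - gen (Chev_K Node1) * gen (Chev_K Node0)
      \<in> Uq_relations q"
| K_E_same:
    "gen (Chev_K i) * gen (Chev_E i s) * gen (Chev_Kinv i)
       - const (q powi (2 * sign_int s)) * gen (Chev_E i s) \<in> Uq_relations q"
| K_E_diff:
    "i \<noteq> j \<Longrightarrow>
     gen (Chev_K i) * gen (Chev_E j s) * gen (Chev_Kinv i)
       - const (q powi (- 2 * sign_int s)) * gen (Chev_E j s) \<in> Uq_relations q"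
| E_commutator:
    "gen (Chev_E i Plus) * gen (Chev_E i Minus) - gen (Chev_E i Minus) * gen (Chev_E i Plus)
       - const (inverse (q - inverse q)) * (gen (Chev_K i) - gen (Chev_Kinv i))
      \<in> Uq_relations q"
| E_mixed:
    "gen (Chev_E Node0 s) * gen (Chev_E Node1 (opposite s))
       - gen (Chev_E Node1 (opposite s)) * gen (Chev_E Node0 s) \<in> Uq_relations q"
| Serre:
    "i \<noteq> j \<Longrightarrow>
     gen (Chev_E i s) ^ 3 * gen (Chev_E j s)
       - const (qint q 3) * (gen (Chev_E i s) ^ 2 * gen (Chev_E j s) * gen (Chev_E i s))
       + const (qint q 3) * (gen (Chev_E i s) * gen (Chev_E j s) * gen (Chev_E i s) ^ 2)
       - gen (Chev_E j s) * gen (Chev_E i s) ^ 3 \<in> Uq_relations q"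

definition Uq_ideal :: "'k::field \<Rightarrow> 'k free_alg set" where
  "Uq_ideal q = Idl\<^bsub>free_ring\<^esub> (Uq_relations q)"

definition Uq :: "'k::field \<Rightarrow> ('k free_alg set) ring" where
  "Uq q = free_ring Quot Uq_ideal q"

definition Uq_class :: "'k::field \<Rightarrow> 'k free_alg \<Rightarrow> 'k free_alg set" where
  "Uq_class q a = Uq_ideal q +>\<^bsub>free_ring\<^esub> a"

abbreviation Uq_K :: "'k::field \<Rightarrow> node \<Rightarrow> 'k free_alg set" where
  "Uq_K q i \<equiv> Uq_class q (gen (Chev_K i))"


section \<open>Modules\<close>

text \<open>
  A (unital, left) module over the \<open>'k\<close>-algebra \<open>Uq q\<close>: the whole type \<open>'v\<close> with scalar
  multiplication \<open>scale\<close>.  The last assumption says that the scalars of the algebra act as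
  the scalars of the vector space; \<open>act\<close> is unconstrained outside \<open>carrier (Uq q)\<close>.
\<close>

locale Uq_module = vector_space scale
  for scale :: "'k::field \<Rightarrow> 'v::ab_group_add \<Rightarrow> 'v" +
  fixes q :: 'k and act :: "'k free_alg set \<Rightarrow> 'v \<Rightarrow> 'v"
  assumes act_add_right:
      "u \<in> carrier (Uq q) \<Longrightarrow> act u (v + w) = act u v + act u w"
    and act_add_left:
      "\<lbrakk>u \<in> carrier (Uq q); u' \<in> carrier (Uq q)\<rbrakk>
        \<Longrightarrow> act (u \<oplus>\<^bsub>Uq q\<^esub> u') v = act u v + act u' v"
    and act_mult:
      "\<lbrakk>u \<in> carrier (Uq q); u' \<in> carrier (Uq q)\<rbrakk>
        \<Longrightarrow> act (u \<otimes>\<^bsub>Uq q\<^esub> u') v = act u (act u' v)"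
    and act_one: "act \<one>\<^bsub>Uq q\<^esub> v = v"
    and act_const: "act (Uq_class q (const c)) v = scale c v"

definition Uq_submodule ::
  "('k::field \<Rightarrow> 'v::ab_group_add \<Rightarrow> 'v) \<Rightarrow> 'k \<Rightarrow> ('k free_alg set \<Rightarrow> 'v \<Rightarrow> 'v) \<Rightarrow> 'v set \<Rightarrow> bool"
  where
  "Uq_submodule scale q act W \<longleftrightarrow>
     module.subspace scale W \<and> (\<forall>u\<in>carrier (Uq q). \<forall>w\<in>W. act u w \<in> W)"

text \<open>The ambient module is the internal direct sum of the submodules \<open>W i\<close>, \<open>i \<in> I\<close>.\<close>

definition direct_sum_of_submodules ::
  "('k::field \<Rightarrow> 'v::ab_group_add \<Rightarrow> 'v) \<Rightarrow> 'k \<Rightarrow> ('k free_alg set \<Rightarrow> 'v \<Rightarrow> 'v)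
     \<Rightarrow> 'i set \<Rightarrow> ('i \<Rightarrow> 'v set) \<Rightarrow> bool"
  where
  "direct_sum_of_submodules scale q act I W \<longleftrightarrow>
     finite I \<and> (\<forall>i\<in>I. Uq_submodule scale q act (W i)) \<and>
     (\<forall>v. \<exists>!f. f \<in> (\<Pi>\<^sub>E i\<in>I. W i) \<and> v = (\<Sum>i\<in>I. f i))"

definition diagonalizable_endo ::
  "('k::field \<Rightarrow> 'v::ab_group_add \<Rightarrow> 'v) \<Rightarrow> ('v \<Rightarrow> 'v) \<Rightarrow> bool"
  where
  "diagonalizable_endo scale f \<longleftrightarrow>
     (\<exists>B. \<not> module.dependent scale B \<and> module.span scale B = UNIV \<and>
          (\<forall>b\<in>B. \<exists>c. f b = scale c b))"

datatype parity = Even_part | Odd_part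

fun has_parity :: "parity \<Rightarrow> int \<Rightarrow> bool" where
  "has_parity Even_part i \<longleftrightarrow> even i"
| "has_parity Odd_part i \<longleftrightarrow> odd i"

definition V_part ::
  "('k::field \<Rightarrow> 'v::ab_group_add \<Rightarrow> 'v) \<Rightarrow> 'k \<Rightarrow> ('k free_alg set \<Rightarrow> 'v \<Rightarrow> 'v)
     \<Rightarrow> 'k \<Rightarrow> 'k \<Rightarrow> parity \<Rightarrow> 'v set"
  where
  "V_part scale q act \<epsilon>0 \<epsilon>1 \<sigma> =
     module.span scale
       {v. \<exists>i::int. has_parity \<sigma> i \<and>
             act (Uq_K q Node0) v = scale (\<epsilon>0 * q powi i) v \<and>
             act (Uq_K q Node1) v = scale (\<epsilon>1 * q powi (- i)) v}"

end

theory Submission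
  imports Defs
begin

text \<open>
  Call \<open>\<chi> :: node \<Rightarrow> 'k\<close> a weight if some nonzero vector satisfies \<open>K\<^sub>i v = \<chi>\<^sub>i v\<close> for both \<open>i\<close>.
  Since \<open>K\<^sub>0\<close> and \<open>K\<^sub>1\<close> commute and are diagonalizable, the weight vectors span the module, and
  weight vectors of distinct weights are independent.  Hence any partition of the weights into
  classes splits the vector space (\<open>weight_partition_direct_sum\<close>), and a class that is closed
  under the shifts caused by the \<open>e\<^sub>i\<^sup>\<plusminus>\<close> spans a submodule.  Everything rests on showing that every
  weight has the form \<open>(\<epsilon>\<^sub>0 q\<^sup>a, \<epsilon>\<^sub>1 q\<^sup>-\<^sup>a)\<close>; since \<open>e\<^sub>i\<^sup>\<plusminus>\<close> changes \<open>a\<close> by \<open>\<plusminus>2\<close>, the signs and the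
  parity of \<open>a\<close> are then constant along shifts, and they are determined by the weight because \<open>q\<close>
  is not a root of unity.

  For the form of a weight, each node gives a copy of \<open>U\<^sub>q(sl\<^sub>2)\<close>.  Pushing a weight vector up to a
  highest weight vector and then down until it dies shows that \<open>\<chi>\<^sub>i\<^sup>2 = q\<^sup>2\<^sup>a\<close> for an integer \<open>a\<close>, and
  that the set of weights is stable under the \<open>i\<close>-th simple reflection, which shifts \<open>\<chi>\<close> by \<open>-a\<close>
  steps (\<open>weight_reflection\<close>).  The composition of the two simple reflections is a translation of
  the affine Weyl group: if \<open>\<chi>\<^sub>0\<^sup>2 = q\<^sup>2\<^sup>a\<close> and \<open>\<chi>\<^sub>1\<^sup>2 = q\<^sup>2\<^sup>b\<close>, it shifts \<open>\<chi>\<close> by \<open>a + b\<close> steps and leaves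
  \<open>a + b\<close> unchanged.  Iterating it would produce infinitely many weights unless \<open>a + b = 0\<close>, and
  a finite-dimensional module has only finitely many (\<open>weight_level_zero\<close>).
\<close>

section \<open>Sums of eigenvectors\<close>

context vector_space
begin

text \<open>
  Allowing a family of operators \<open>T j\<close> makes this cover simultaneous eigenvectors: two distinct
  families of eigenvalues differ at some \<open>j\<close>, and applying \<open>T j - \<mu> a j\<close> then removes the summand
  \<open>f a\<close> but only rescales \<open>f b\<close> by a nonzero factor.
\<close>

lemma eigenvectors_sum_eq_0:
  fixes T :: "'j \<Rightarrow> 'b \<Rightarrow> 'b" and \<mu> :: "'i \<Rightarrow> 'j \<Rightarrow> 'a"
  assumes add: "\<And>j v w. T j (v + w) = T j v + T j w"
    and scale: "\<And>j c v. T j (scale c v) = scale c (T j v)"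
    and fin: "finite I" and inj: "inj_on \<mu> I"
    and eig: "\<And>i j. i \<in> I \<Longrightarrow> T j (f i) = scale (\<mu> i j) (f i)"
    and sum: "(\<Sum>i\<in>I. f i) = 0" and "i \<in> I"
  shows "f i = 0"
  using fin inj eig sum \<open>i \<in> I\<close>
proof (induction I arbitrary: f i rule: finite_induct)
  case (insert a I)
  have T0: "T j 0 = 0" for j using scale[of j 0 0] by simp
  have Tsum: "T j (\<Sum>i\<in>X. g i) = (\<Sum>i\<in>X. T j (g i))" for j g and X :: "'i set"
    by (induction X rule: infinite_finite_induct) (auto simp: add T0)
  have rest: "f b = 0" if b: "b \<in> I" for b
  proof -
    have "\<mu> b \<noteq> \<mu> a" using insert.prems(1) insert.hyps(2) b by (auto simp: inj_on_def)
    then obtain j where j: "\<mu> b j \<noteq> \<mu> a j" by (auto simp: fun_eq_iff)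
    have "(\<Sum>i\<in>I. scale (\<mu> i j - \<mu> a j) (f i))
        = (\<Sum>i\<in>insert a I. scale (\<mu> i j - \<mu> a j) (f i))"
      using insert.hyps by simp
    also have "\<dots> = (\<Sum>i\<in>insert a I. T j (f i)) - scale (\<mu> a j) (\<Sum>i\<in>insert a I. f i)"
      unfolding scale_sum_right sum_subtractf[symmetric]
      by (intro sum.cong refl) (simp add: insert.prems(2) scale_left_diff_distrib)
    also have "\<dots> = 0"
      unfolding Tsum[symmetric] insert.prems(3) by (simp add: T0)
    finally have s: "(\<Sum>i\<in>I. scale (\<mu> i j - \<mu> a j) (f i)) = 0" .
    have "scale (\<mu> b j - \<mu> a j) (f b) = 0"
    proof (rule insert.IH[OF _ _ s b])
      show "inj_on \<mu> I" using insert.prems(1) by (simp add: inj_on_def)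
      show "T k (scale (\<mu> i j - \<mu> a j) (f i)) = scale (\<mu> i k) (scale (\<mu> i j - \<mu> a j) (f i))"
        if "i \<in> I" for i k
        using that by (simp add: scale insert.prems(2) mult.commute)
    qed
    then show ?thesis using j by simp
  qed
  then have "f a = 0" using insert.prems(3) insert.hyps by simp
  then show ?case using rest insert.prems(4) by auto
qed simp

lemma diagonalizable_eigenvector_sum:
  assumes diag: "diagonalizable_endo scale T"
    and scale: "\<And>c v. T (scale c v) = scale c (T v)" and add: "\<And>v w. T (v + w) = T v + T w"
  obtains C g where "finite C" "\<And>c. T (g c) = scale c (g c)" "v = (\<Sum>c\<in>C. g c)"
proof -
  obtain B ev where B: "span B = UNIV" "\<And>b. b \<in> B \<Longrightarrow> T b = scale (ev b) b"
    using diag unfolding diagonalizable_endo_def by metis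
  have "v \<in> span B" using B(1) by simp
  then obtain t r where t: "finite t" "t \<subseteq> B" "v = (\<Sum>b\<in>t. scale (r b) b)"
    unfolding span_explicit by blast
  have T0: "T 0 = 0" using scale[of 0 0] by simp
  have Tsum: "T (\<Sum>b\<in>X. f b) = (\<Sum>b\<in>X. T (f b))" for f :: "'b \<Rightarrow> 'b" and X
    by (induction X rule: infinite_finite_induct) (auto simp: add T0)
  let ?g = "\<lambda>c. \<Sum>b | b \<in> t \<and> ev b = c. scale (r b) b"
  have "T (?g c) = scale c (?g c)" for c
    unfolding Tsum scale_sum_right
    by (intro sum.cong refl) (use t(2) B(2) in \<open>auto simp: scale scale_left_commute\<close>)
  moreover have "v = (\<Sum>c\<in>ev ` t. ?g c)"
    using t(3) sum.image_gen[OF t(1), of "\<lambda>b. scale (r b) b" ev] by simp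
  ultimately show ?thesis using that[of "ev ` t" ?g] t(1) by blast
qed

end

section \<open>The action of the generators\<close>

lemma Uq_ideal_ideal: "ideal (Uq_ideal q) free_ring"
  unfolding Uq_ideal_def
  by (rule ring.genideal_ideal[OF ring_free_ring]) (simp add: free_ring_def)

lemma Uq_class_hom: "Uq_class q \<in> ring_hom free_ring (Uq q)"
proof -
  have "Uq_class q = (+>\<^bsub>free_ring\<^esub>) (Uq_ideal q)"
    by (simp add: Uq_class_def fun_eq_iff)
  then show ?thesis
    using ideal.rcos_ring_hom[OF Uq_ideal_ideal] by (simp add: Uq_def)
qed

lemma Uq_class_carrier [simp]: "Uq_class q a \<in> carrier (Uq q)"
  using ring_hom_closed[OF Uq_class_hom, of a] by (simp add: free_ring_def)

lemma Uq_class_add: "Uq_class q (a + b) = Uq_class q a \<oplus>\<^bsub>Uq q\<^esub> Uq_class q b"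
  using ring_hom_add[OF Uq_class_hom, of a b] by (simp add: free_ring_def)

lemma Uq_class_mult: "Uq_class q (a * b) = Uq_class q a \<otimes>\<^bsub>Uq q\<^esub> Uq_class q b"
  using ring_hom_mult[OF Uq_class_hom, of a b] by (simp add: free_ring_def)

lemma Uq_class_one: "Uq_class q 1 = \<one>\<^bsub>Uq q\<^esub>"
  using ring_hom_one[OF Uq_class_hom] by (simp add: free_ring_def)

lemma Uq_class_relation:
  assumes "r \<in> Uq_relations q"
  shows "Uq_class q r = Uq_class q 0"
proof -
  have *: "a \<in> Uq_ideal q \<Longrightarrow> Uq_class q a = Uq_ideal q" for a
    unfolding Uq_class_def
    by (rule ring.a_rcos_zero[OF ring_free_ring Uq_ideal_ideal])
  have "r \<in> Uq_ideal q"
    using assms ring.genideal_self[OF ring_free_ring, of "Uq_relations q"]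
    by (auto simp: Uq_ideal_def free_ring_def)
  moreover have "0 \<in> Uq_ideal q"
    using additive_subgroup.zero_closed[OF ideal.axioms(1)[OF Uq_ideal_ideal], of q]
    by (simp add: free_ring_def)
  ultimately show ?thesis using * by simp
qed

lemma carrier_Uq_E:
  assumes "u \<in> carrier (Uq q)"
  obtains a where "u = Uq_class q a"
  using assms by (auto simp: Uq_def FactRing_def A_RCOSETS_def' Uq_class_def)

text \<open>
  Statements about all elements of the algebra reduce to scalars and words through this
  expansion.
\<close>

lemma free_alg_eq_sum_words:
  "(a :: 'k::field free_alg) =
     (\<Sum>w\<in>Poly_Mapping.keys a. const (Poly_Mapping.lookup a w) * Poly_Mapping.single w 1)"
  by (rule poly_mapping_eqI)
    (simp add: const_def mult_single lookup_sum lookup_single when_def in_keys_iff)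

lemma const_commute: "a * const c = const c * (a :: 'k::field free_alg)"
proof -
  let ?S = "\<Sum>w\<in>Poly_Mapping.keys a. const (Poly_Mapping.lookup a w) * Poly_Mapping.single w 1"
  have "?S * const c = const c * ?S"
    by (simp add: sum_distrib_left sum_distrib_right const_def mult_single mult.commute)
  then show ?thesis by (simp flip: free_alg_eq_sum_words)
qed

context Uq_module
begin

definition rep :: "'k free_alg \<Rightarrow> 'v \<Rightarrow> 'v" where
  "rep a = act (Uq_class q a)"

abbreviation K :: "node \<Rightarrow> 'v \<Rightarrow> 'v" where "K i \<equiv> rep (gen (Chev_K i))"
abbreviation Kinv :: "node \<Rightarrow> 'v \<Rightarrow> 'v" where "Kinv i \<equiv> rep (gen (Chev_Kinv i))"
abbreviation E :: "node \<Rightarrow> sign \<Rightarrow> 'v \<Rightarrow> 'v" where "E i s \<equiv> rep (gen (Chev_E i s))"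

lemma rep_add: "rep (a + b) v = rep a v + rep b v"
  by (simp add: rep_def Uq_class_add act_add_left)

lemma rep_mult: "rep (a * b) v = rep a (rep b v)"
  by (simp add: rep_def Uq_class_mult act_mult)

lemma rep_one [simp]: "rep 1 v = v"
  by (simp add: rep_def Uq_class_one act_one)

lemma rep_const [simp]: "rep (const c) v = scale c v"
  by (simp add: rep_def act_const)

lemma rep_zero [simp]: "rep 0 v = 0"
  using rep_const[of 0 v] by (simp add: const_def)

lemma rep_diff: "rep (a - b) v = rep a v - rep b v"
  using rep_add[of "a - b" b v] by (simp add: algebra_simps)

lemma rep_add_right: "rep a (v + w) = rep a v + rep a w"
  by (simp add: rep_def act_add_right)

lemma rep_scale: "rep a (scale c v) = scale c (rep a v)"
  by (metis const_commute rep_mult rep_const)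

lemma rep_zero_right [simp]: "rep a 0 = 0"
  using rep_scale[of a 0 0] by simp

lemma rep_sum_right: "rep a (\<Sum>x\<in>X. f x) = (\<Sum>x\<in>X. rep a (f x))"
  by (induction X rule: infinite_finite_induct) (auto simp: rep_add_right)

lemma rep_sum_left: "rep (\<Sum>x\<in>X. f x) v = (\<Sum>x\<in>X. rep (f x) v)"
  by (induction X rule: infinite_finite_induct) (auto simp: rep_add)

lemma rep_diff_right: "rep a (v - w) = rep a v - rep a w"
  using rep_add_right[of a "v - w" w] by (simp add: algebra_simps)

lemma rep_relation: "r \<in> Uq_relations q \<Longrightarrow> rep r v = 0"
  using rep_zero[of v] by (simp add: rep_def Uq_class_relation)

lemma Kinv_K: "Kinv i (K i v) = v"
  using rep_relation[OF Uq_relations.Kinv_K[of i q], of v] by (simp add: rep_diff rep_mult)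

lemma K_commute: "K i (K j v) = K j (K i v)"
proof -
  have "K Node0 (K Node1 v) = K Node1 (K Node0 v)"
    using rep_relation[OF Uq_relations.K_commute[of q], of v] by (simp add: rep_diff rep_mult)
  then show ?thesis by (cases i; cases j) auto
qed

lemma K_E:
  "K i (E j s v) = scale (q powi ((if i = j then 2 else - 2) * sign_int s)) (E j s (K i v))"
  using rep_relation[OF Uq_relations.K_E_same[of i s q], of "K i v"]
    rep_relation[OF Uq_relations.K_E_diff[of i j s q], of "K i v"]
  by (auto simp: rep_diff rep_mult Kinv_K)

lemma E_commutator:
  "E i Plus (E i Minus v) - E i Minus (E i Plus v)
     = scale (inverse (q - inverse q)) (K i v - Kinv i v)"
  using rep_relation[OF Uq_relations.E_commutator[of i q], of v]
  by (simp add: rep_diff rep_mult)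

lemma subspace_rep_closed:
  assumes W: "subspace W" and gens: "\<And>x w. w \<in> W \<Longrightarrow> rep (gen x) w \<in> W" and w: "w \<in> W"
  shows "rep a w \<in> W"
proof -
  have word: "rep (Poly_Mapping.single (Word xs) 1) w \<in> W" for xs
  proof (induction xs)
    case Nil
    have "Poly_Mapping.single (Word []) (1::'k) = 1"
      by (metis single_one zero_word_def)
    then show ?case using w by simp
  next
    case (Cons x xs)
    have "Poly_Mapping.single (Word (x # xs)) (1::'k) = gen x * Poly_Mapping.single (Word xs) 1"
      by (simp add: gen_def mult_single plus_word_def)
    then show ?case using gens[OF Cons.IH] by (simp add: rep_mult)
  qed
  have "rep a w = (\<Sum>u\<in>Poly_Mapping.keys a.
      scale (Poly_Mapping.lookup a u) (rep (Poly_Mapping.single u 1) w))"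
    by (subst free_alg_eq_sum_words[of a]) (simp add: rep_sum_left rep_mult)
  also have "\<dots> \<in> W"
  proof (intro subspace_sum W subspace_scale)
    fix u show "rep (Poly_Mapping.single u 1) w \<in> W"
      using word[of "letters u"] by simp
  qed
  finally show ?thesis .
qed

text \<open>
  Every element of the algebra is the class of a linear combination of products of generators.
\<close>

lemma Uq_submodule_if_generators_closed:
  assumes "subspace W" and "\<And>x w. w \<in> W \<Longrightarrow> rep (gen x) w \<in> W"
  shows "Uq_submodule scale q act W"
  unfolding Uq_submodule_def
  using subspace_rep_closed[OF assms] assms(1) by (metis carrier_Uq_E rep_def)

end

section \<open>Weight vectors\<close>

context Uq_module
begin

definition weight_vector :: "(node \<Rightarrow> 'k) \<Rightarrow> 'v \<Rightarrow> bool" where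
  "weight_vector \<chi> v \<longleftrightarrow> (\<forall>i. K i v = scale (\<chi> i) v)"

definition is_weight :: "(node \<Rightarrow> 'k) \<Rightarrow> bool" where
  "is_weight \<chi> \<longleftrightarrow> (\<exists>v. v \<noteq> 0 \<and> weight_vector \<chi> v)"

text \<open>
  The effect on a weight of \<open>t\<close> applications of \<open>e\<^sub>i\<^sup>+\<close>, or of \<open>-t\<close> applications of \<open>e\<^sub>i\<^sup>-\<close>.  As both
  nodes are affected in opposite ways, \<open>shift Node1 t\<close> equals \<open>shift Node0 (- t)\<close>.
\<close>

definition shift :: "node \<Rightarrow> int \<Rightarrow> (node \<Rightarrow> 'k) \<Rightarrow> node \<Rightarrow> 'k" where
  "shift i t \<chi> = (\<lambda>j. \<chi> j * q powi ((if j = i then 2 else - 2) * t))"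

lemma weight_vector_add:
  "weight_vector \<chi> v \<Longrightarrow> weight_vector \<chi> w \<Longrightarrow> weight_vector \<chi> (v + w)"
  by (simp add: weight_vector_def rep_add_right scale_right_distrib)

lemma weight_vector_scale: "weight_vector \<chi> v \<Longrightarrow> weight_vector \<chi> (scale c v)"
  by (simp add: weight_vector_def rep_scale scale_left_commute)

lemma weight_vector_zero: "weight_vector \<chi> 0"
  by (simp add: weight_vector_def)

lemma weight_vector_sum:
  "(\<And>x. x \<in> X \<Longrightarrow> weight_vector \<chi> (f x)) \<Longrightarrow> weight_vector \<chi> (\<Sum>x\<in>X. f x)"
  by (induction X rule: infinite_finite_induct) (auto simp: weight_vector_add weight_vector_zero)

lemma weight_vector_E:
  "weight_vector \<chi> v \<Longrightarrow> weight_vector (shift i (sign_int s) \<chi>) (E i s v)"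
  by (simp add: weight_vector_def K_E shift_def rep_scale mult.commute)

lemma weight_nonzero:
  assumes "is_weight \<chi>"
  shows "\<chi> i \<noteq> 0"
proof
  assume "\<chi> i = 0"
  with assms obtain v where "v \<noteq> 0" "K i v = 0" by (auto simp: is_weight_def weight_vector_def)
  then show False using Kinv_K[of i v] by simp
qed

lemma Kinv_weight_vector:
  assumes "weight_vector \<chi> v"
  shows "Kinv i v = scale (inverse (\<chi> i)) v"
proof (cases "v = 0")
  case False
  then have "\<chi> i \<noteq> 0" using assms weight_nonzero is_weight_def by blast
  moreover have "v = scale (\<chi> i) (Kinv i v)"
    using assms Kinv_K[of i v] by (simp add: weight_vector_def rep_scale)
  ultimately show ?thesis
    by (metis scale_one scale_scale left_inverse)
qed simp

lemma weight_vectors_sum_eq_0: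
  assumes "finite X" "\<And>\<chi>. \<chi> \<in> X \<Longrightarrow> weight_vector \<chi> (f \<chi>)" "(\<Sum>\<chi>\<in>X. f \<chi>) = 0" "\<chi> \<in> X"
  shows "f \<chi> = 0"
  by (rule eigenvectors_sum_eq_0[where T = K and \<mu> = "\<lambda>\<chi>. \<chi>" and I = X])
    (use assms in \<open>auto simp: weight_vector_def rep_add_right rep_scale\<close>)

text \<open>
  Choosing one nonzero weight vector for every weight gives an independent family.
\<close>

lemma finite_weights:
  assumes "finite_dimensional_vector_space scale B"
  shows "finite {\<chi>. is_weight \<chi>}"
proof -
  interpret F: finite_dimensional_vector_space scale B by fact
  obtain v where v: "\<And>\<chi>. is_weight \<chi> \<Longrightarrow> v \<chi> \<noteq> 0 \<and> weight_vector \<chi> (v \<chi>)"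
    using that[of "\<lambda>\<chi>. SOME v. v \<noteq> 0 \<and> weight_vector \<chi> v"]
    unfolding is_weight_def by (metis (mono_tags, lifting) someI_ex)
  let ?X = "{\<chi>. is_weight \<chi>}"
  have inj: "inj_on v ?X"
  proof (rule inj_onI, rule ccontr)
    fix \<chi> \<psi> assume *: "\<chi> \<in> ?X" "\<psi> \<in> ?X" "v \<chi> = v \<psi>" "\<chi> \<noteq> \<psi>"
    then obtain i where "\<chi> i \<noteq> \<psi> i" by (auto simp: fun_eq_iff)
    moreover have "scale (\<chi> i) (v \<chi>) = scale (\<psi> i) (v \<chi>)"
      using v[of \<chi>] v[of \<psi>] * by (auto simp: weight_vector_def)
    ultimately show False using v[of \<chi>] * by simp
  qed
  have "independent (v ` ?X)"
    unfolding independent_explicit_module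
  proof (intro allI impI)
    fix t u w assume t: "finite t" "t \<subseteq> v ` ?X" and s: "(\<Sum>x\<in>t. scale (u x) x) = 0" and w: "w \<in> t"
    obtain X where X: "X \<subseteq> ?X" "t = v ` X" using t(2) by (auto simp: subset_image_iff)
    have injX: "inj_on v X" using inj X(1) inj_on_subset by blast
    have finX: "finite X" using t(1) X(2) injX finite_imageD by blast
    obtain \<chi> where \<chi>: "\<chi> \<in> X" "w = v \<chi>" using w X(2) by auto
    have "scale (u (v \<chi>)) (v \<chi>) = 0"
    proof (rule weight_vectors_sum_eq_0[where X = X and f = "\<lambda>\<chi>. scale (u (v \<chi>)) (v \<chi>)"])
      show "(\<Sum>\<chi>\<in>X. scale (u (v \<chi>)) (v \<chi>)) = 0"
        using s by (simp add: X(2) sum.reindex[OF injX])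
    qed (use finX X(1) v \<chi> weight_vector_scale in auto)
    then show "u w = 0" using v X(1) \<chi> by auto
  qed
  then have "finite (v ` ?X)" by (rule F.finiteI_independent)
  then show ?thesis using inj finite_imageD by blast
qed

text \<open>
  Simultaneous diagonalization: split an eigenvector of \<open>K\<^sub>0\<close> into eigenvectors of \<open>K\<^sub>1\<close>.  Since
  \<open>K\<^sub>0\<close> preserves the eigenspaces of \<open>K\<^sub>1\<close>, independence of these eigenspaces forces each component
  to be an eigenvector of \<open>K\<^sub>0\<close> as well.
\<close>

lemma span_weight_vectors:
  assumes diag: "\<And>i. diagonalizable_endo scale (K i)"
  shows "span {v. \<exists>\<chi>. weight_vector \<chi> v} = UNIV"
proof -
  have eigen: "u \<in> span {v. \<exists>\<chi>. weight_vector \<chi> v}" if u: "K Node0 u = scale c u" for c u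
  proof -
    obtain D g where D: "finite D" "\<And>d. K Node1 (g d) = scale d (g d)" "u = (\<Sum>d\<in>D. g d)"
      using diagonalizable_eigenvector_sum[OF diag[of Node1], of u] rep_scale rep_add_right by metis
    have "(\<Sum>d\<in>D. K Node0 (g d) - scale c (g d)) = K Node0 u - scale c u"
      by (simp add: D(3) rep_sum_right sum_subtractf scale_sum_right)
    then have total: "(\<Sum>d\<in>D. K Node0 (g d) - scale c (g d)) = 0" using u by simp
    have "K Node0 (g d) - scale c (g d) = 0" if "d \<in> D" for d
    proof (rule eigenvectors_sum_eq_0[where T = "\<lambda>_::unit. K Node1" and \<mu> = "\<lambda>d _. d" and I = D])
      show "K Node1 (K Node0 (g d) - scale c (g d)) = scale d (K Node0 (g d) - scale c (g d))" for d
        by (simp add: rep_diff_right K_commute[of Node1 Node0] D(2) rep_scale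
            scale_right_diff_distrib scale_left_commute)
      show "inj_on (\<lambda>d _::unit. d) D" by (auto simp: inj_on_def fun_eq_iff)
    qed (use D(1) total that in \<open>auto simp: rep_add_right rep_scale\<close>)
    then have "weight_vector (case_node c d) (g d)" if "d \<in> D" for d
      using that D(2) by (auto simp: weight_vector_def split: node.split)
    then show ?thesis unfolding D(3) by (intro span_sum span_base) blast
  qed
  have "v \<in> span {v. \<exists>\<chi>. weight_vector \<chi> v}" for v
  proof -
    obtain D g where D: "finite D" "\<And>d. K Node0 (g d) = scale d (g d)" "v = (\<Sum>d\<in>D. g d)"
      using diagonalizable_eigenvector_sum[OF diag[of Node0], of v] rep_scale rep_add_right by metis
    show ?thesis unfolding D(3) by (intro span_sum) (rule eigen[OF D(2)])
  qed
  then show ?thesis by blast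
qed

end

section \<open>Strings of weights\<close>

lemma opposite_opposite [simp]: "opposite (opposite s) = s"
  by (cases s) auto

lemma sign_int_opposite [simp]: "sign_int (opposite s) = - sign_int s"
  by (cases s) auto

lemma sum_inverse_powers:
  fixes x :: "'a::field"
  assumes "x \<noteq> 0"
  shows "x ^ n * (\<Sum>l\<le>n. inverse x ^ l) = (\<Sum>l\<le>n. x ^ l)"
proof -
  have "x ^ n * (\<Sum>l\<le>n. inverse x ^ l) = (\<Sum>l\<le>n. x ^ (n - l))"
    unfolding sum_distrib_left
    by (intro sum.cong refl) (use assms in \<open>simp add: power_diff field_simps\<close>)
  also have "\<dots> = (\<Sum>l\<le>n. x ^ l)"
    using sum.atLeastAtMost_rev[of "\<lambda>l. x ^ l" 0 n] by (simp add: atLeast0AtMost)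
  finally show ?thesis .
qed

locale finite_dimensional_generic_Uq_module = Uq_module scale q act
  for scale :: "'k::field \<Rightarrow> 'v::ab_group_add \<Rightarrow> 'v" and q act +
  assumes q_nonzero: "q \<noteq> 0"
    and q_generic: "0 < n \<Longrightarrow> q ^ n \<noteq> 1"
    and finite_dimensional: "\<exists>B. finite_dimensional_vector_space scale B"
begin

lemma finitely_many_weights: "finite {\<chi>. is_weight \<chi>}"
  using finite_dimensional finite_weights by blast

lemma q_powi_eq_iff [simp]: "q powi m = q powi n \<longleftrightarrow> m = n"
proof -
  have *: "m = n" if "q powi m = q powi n" "m \<le> n" for m n
  proof (rule ccontr)
    assume "m \<noteq> n"
    have "q powi (n - m) = 1" using that(1) q_nonzero by (simp add: power_int_diff)
    then have "q ^ nat (n - m) = 1" using that(2) by (simp add: power_int_nonneg_exp)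
    then show False using q_generic[of "nat (n - m)"] that(2) \<open>m \<noteq> n\<close> by auto
  qed
  then show ?thesis by (metis linear)
qed

lemma q_diff_inverse_nonzero: "q - inverse q \<noteq> 0"
  using q_powi_eq_iff[of 1 "- 1"] q_nonzero by (simp add: power_int_minus)

lemma q_powi_mult [simp]: "q powi a * q powi b = q powi (a + b)"
  using q_nonzero by (simp add: power_int_add)

lemma mult_q_powi_mult [simp]: "x * q powi a * q powi b = x * q powi (a + b)"
  by (simp add: mult.assoc)

lemma q_powi_square [simp]: "(x * q powi a)\<^sup>2 = x\<^sup>2 * q powi (2 * a)"
  by (simp add: power_mult_distrib power_int_power' mult.commute)

lemma shift_shift: "shift i a (shift i b \<chi>) = shift i (a + b) \<chi>"
  by (auto simp: shift_def fun_eq_iff)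

lemma shift_zero [simp]: "shift i 0 \<chi> = \<chi>"
  by (simp add: shift_def)

lemma shift_inject:
  assumes "is_weight \<chi>" "shift i a \<chi> = shift i b \<chi>"
  shows "a = b"
  using fun_cong[OF assms(2), of i] weight_nonzero[OF assms(1)]
  by (simp add: shift_def)

lemma weight_vector_E_power:
  assumes "weight_vector \<chi> v"
  shows "weight_vector (shift i (sign_int s * int k) \<chi>) ((E i s ^^ k) v)"
proof (induction k)
  case (Suc k)
  from weight_vector_E[OF this, of i s] show ?case
    by (simp add: shift_shift distrib_left)
qed (use assms in simp)

text \<open>
  The nonzero vectors obtained by applying \<open>e\<^sub>i\<^sup>s\<close> repeatedly have pairwise distinct weights, of
  which there are only finitely many.
\<close>

lemma E_nilpotent_on_weight_vector:
  assumes "weight_vector \<chi> v" "v \<noteq> 0"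
  obtains k where "\<And>j. j \<le> k \<Longrightarrow> (E i s ^^ j) v \<noteq> 0" "(E i s ^^ Suc k) v = 0"
proof -
  have wt: "is_weight \<chi>" using assms is_weight_def by blast
  have "\<exists>k. (E i s ^^ k) v = 0"
  proof (rule ccontr)
    assume "\<nexists>k. (E i s ^^ k) v = 0"
    then have "range (\<lambda>k::nat. shift i (sign_int s * int k) \<chi>) \<subseteq> {\<chi>. is_weight \<chi>}"
      using weight_vector_E_power[OF assms(1), of i s] unfolding is_weight_def by blast
    then have "finite (range (\<lambda>k::nat. shift i (sign_int s * int k) \<chi>))"
      using finitely_many_weights finite_subset by blast
    moreover have "inj (\<lambda>k::nat. shift i (sign_int s * int k) \<chi>)"
      by (rule injI, drule shift_inject[OF wt]) (cases s; simp)
    ultimately show False using finite_imageD by blast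
  qed
  then have least: "(E i s ^^ (LEAST k. (E i s ^^ k) v = 0)) v = 0" (is "(_ ^^ ?m) v = 0")
    by (rule LeastI_ex)
  with assms(2) obtain k where k: "?m = Suc k" by (cases ?m) auto
  have "(E i s ^^ j) v \<noteq> 0" if "j \<le> k" for j
    using not_less_Least[of j "\<lambda>k. (E i s ^^ k) v = 0"] that k by auto
  then show ?thesis using that least k by metis
qed

text \<open>
  The automorphism of \<open>U\<^sub>q(sl\<^sub>2)\<close> that exchanges \<open>e\<^sup>+\<close> with \<open>e\<^sup>-\<close> also inverts \<open>K\<close>; using
  \<open>\<chi>\<^sub>i\<^sup>\<plusminus>\<^sup>1\<close> according to the sign \<open>s\<close> lets the arguments below treat \<open>e\<^sub>i\<^sup>+\<close> and \<open>e\<^sub>i\<^sup>-\<close>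
  as raising operator at once.
\<close>

lemma E_commutator_weight_vector:
  assumes "weight_vector \<chi> v"
  shows "E i s (E i (opposite s) v) = E i (opposite s) (E i s v)
    + scale ((\<chi> i powi sign_int s - inverse (\<chi> i powi sign_int s)) / (q - inverse q)) v"
proof -
  have "E i Plus (E i Minus v) - E i Minus (E i Plus v)
      = scale ((\<chi> i - inverse (\<chi> i)) / (q - inverse q)) v"
    using assms Kinv_weight_vector[OF assms, of i]
    by (simp add: E_commutator weight_vector_def divide_inverse mult.commute
        flip: scale_left_diff_distrib)
  moreover have "(inverse (\<chi> i) - \<chi> i) / (q - inverse q) = - ((\<chi> i - inverse (\<chi> i)) / (q - inverse q))"
    by (simp add: minus_divide_left)
  ultimately show ?thesis
    by (cases s) (simp_all add: power_int_minus algebra_simps)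
qed

text \<open>
  Moving the raising operator past the lowering operators one at a time picks up one commutator
  for each vector of the string.
\<close>

lemma E_on_highest_weight_string:
  assumes w: "weight_vector \<psi> w" and hw: "E i s w = 0"
  defines "l \<equiv> \<psi> i powi sign_int s"
  shows "E i s ((E i (opposite s) ^^ Suc m) w) =
    scale ((\<Sum>j\<le>m. l * inverse (q\<^sup>2) ^ j - inverse l * (q\<^sup>2) ^ j) / (q - inverse q))
      ((E i (opposite s) ^^ m) w)"
proof (induction m)
  have step: "E i s ((E i (opposite s) ^^ Suc m) w) =
      E i (opposite s) (E i s ((E i (opposite s) ^^ m) w)) +
      scale ((l * inverse (q\<^sup>2) ^ m - inverse l * (q\<^sup>2) ^ m) / (q - inverse q))
        ((E i (opposite s) ^^ m) w)" for m
  proof -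
    let ?\<mu> = "shift i (sign_int (opposite s) * int m) \<psi>"
    have "?\<mu> i powi sign_int s = l * inverse (q\<^sup>2) ^ m"
      by (cases s) (simp_all add: shift_def l_def power_int_minus power_mult power_int_mult
          power_inverse)
    then show ?thesis
      using E_commutator_weight_vector[OF weight_vector_E_power[OF w, of i "opposite s" m], of i s]
      by (simp add: inverse_eq_divide power_divide)
  qed
  {
    case 0
    show ?case using step[of 0] hw by simp
  next
    case (Suc m)
    show ?case
      unfolding step[of "Suc m"] Suc.IH rep_scale
      by (simp add: add_divide_distrib scale_left_distrib)
  }
qed

text \<open>
  At the bottom of the string the scalar of the previous lemma must vanish.  With \<open>x = q\<^sup>2\<close> and
  \<open>G = 1 + x + \<dots> + x\<^sup>n\<close> it is a nonzero multiple of \<open>(l\<^sup>2 - x\<^sup>n) G\<close>, and \<open>G \<noteq> 0\<close> since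
  \<open>x\<^sup>n\<^sup>+\<^sup>1 \<noteq> 1\<close>.
\<close>

lemma highest_weight_square:
  assumes w: "weight_vector \<psi> w" and hw: "E i s w = 0"
    and top: "(E i (opposite s) ^^ n) w \<noteq> 0" and last: "(E i (opposite s) ^^ Suc n) w = 0"
  shows "(\<psi> i powi sign_int s)\<^sup>2 = q ^ (2 * n)"
proof -
  define l where "l = \<psi> i powi sign_int s"
  define x where "x = q\<^sup>2"
  define G where "G = (\<Sum>j\<le>n. x ^ j)"
  have G_nonzero: "G \<noteq> 0"
  proof
    assume "G = 0"
    then have "q ^ (2 * Suc n) = 1"
      using sum_gp_basic[of x n] by (simp only: G_def x_def power_mult) simp
    then show False using q_generic[of "2 * Suc n"] by simp
  qed
  have "w \<noteq> 0"
  proof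
    assume "w = 0"
    then have "(E i (opposite s) ^^ m) w = 0" for m by (induction m) auto
    then show False using top by blast
  qed
  then have l_nonzero: "l \<noteq> 0"
    using w weight_nonzero[of \<psi> i] by (auto simp: l_def is_weight_def)
  have x_nonzero: "x \<noteq> 0" using q_nonzero by (simp add: x_def)
  have "scale ((\<Sum>j\<le>n. l * inverse x ^ j - inverse l * x ^ j) / (q - inverse q))
      ((E i (opposite s) ^^ n) w) = 0"
    using E_on_highest_weight_string[OF w hw, of n] unfolding last by (simp add: l_def x_def)
  then have "0 = l * x ^ n * (\<Sum>j\<le>n. l * inverse x ^ j - inverse l * x ^ j)"
    using top q_diff_inverse_nonzero by simp
  also have "\<dots> = l\<^sup>2 * (x ^ n * (\<Sum>j\<le>n. inverse x ^ j)) - x ^ n * G"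
    using l_nonzero
    by (simp add: sum_subtractf G_def power2_eq_square algebra_simps flip: sum_distrib_left)
  also have "\<dots> = (l\<^sup>2 - x ^ n) * G"
    by (simp only: sum_inverse_powers[OF x_nonzero] flip: G_def) (simp add: algebra_simps)
  finally show ?thesis
    using G_nonzero by (simp add: l_def x_def power_mult)
qed

text \<open>
  Here \<open>k\<close> is the number of raising steps from \<open>\<chi>\<close> to a highest weight, and \<open>n\<close> the number of
  lowering steps that this highest weight vector survives.
\<close>

lemma weight_string:
  assumes "is_weight \<chi>"
  obtains n k :: nat where "(\<chi> i powi sign_int s)\<^sup>2 = q powi (2 * (int n - 2 * int k))"
    and "\<And>j. j \<le> n \<Longrightarrow> is_weight (shift i (sign_int s * (int k - int j)) \<chi>)"
proof -
  obtain v where v: "v \<noteq> 0" "weight_vector \<chi> v" using assms is_weight_def by blast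
  obtain k where k: "\<And>j. j \<le> k \<Longrightarrow> (E i s ^^ j) v \<noteq> 0" "(E i s ^^ Suc k) v = 0"
    using E_nilpotent_on_weight_vector[OF v(2,1)] by metis
  define w where "w = (E i s ^^ k) v"
  define \<psi> where "\<psi> = shift i (sign_int s * int k) \<chi>"
  have w: "weight_vector \<psi> w" "w \<noteq> 0" "E i s w = 0"
    using weight_vector_E_power[OF v(2)] k by (auto simp: w_def \<psi>_def)
  obtain n where n: "\<And>j. j \<le> n \<Longrightarrow> (E i (opposite s) ^^ j) w \<noteq> 0"
      "(E i (opposite s) ^^ Suc n) w = 0"
    using E_nilpotent_on_weight_vector[OF w(1,2)] by metis
  have "(\<psi> i powi sign_int s)\<^sup>2 = q ^ (2 * n)"
    using highest_weight_square[OF w(1,3)] n by blast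
  moreover have "\<psi> i powi sign_int s = \<chi> i powi sign_int s * q powi (2 * int k)"
    by (cases s) (simp_all add: \<psi>_def shift_def power_int_minus)
  ultimately have e: "(\<chi> i powi sign_int s)\<^sup>2 * q powi (2 * (2 * int k)) = q powi int (2 * n)"
    by (metis q_powi_square power_int_of_nat)
  have "(\<chi> i powi sign_int s)\<^sup>2
      = (\<chi> i powi sign_int s)\<^sup>2 * q powi (2 * (2 * int k)) * q powi (- (2 * (2 * int k)))"
    by simp
  also have "\<dots> = q powi (2 * (int n - 2 * int k))"
    unfolding e q_powi_mult by (simp add: right_diff_distrib)
  finally have sq: "(\<chi> i powi sign_int s)\<^sup>2 = q powi (2 * (int n - 2 * int k))" .
  have "is_weight (shift i (sign_int s * (int k - int j)) \<chi>)" if "j \<le> n" for j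
    using weight_vector_E_power[OF w(1), of i "opposite s" j] n(1)[OF that]
    by (auto simp: is_weight_def \<psi>_def shift_shift algebra_simps)
  then show ?thesis using sq that by blast
qed

text \<open>
  The string through \<open>\<chi>\<close> runs from the highest weight down to its reflection, so it contains the reflection of \<open>\<chi>\<close> whenever \<open>\<chi>\<close> itself lies in its upper half, that is, for
  \<open>n \<ge> 2 k\<close>.  Otherwise \<open>\<chi>\<close> lies in the upper half of the string formed with \<open>e\<^sub>i\<^sup>+\<close> and \<open>e\<^sub>i\<^sup>-\<close>
  exchanged.
\<close>

lemma weight_reflection:
  assumes "is_weight \<chi>"
  obtains a where "(\<chi> i)\<^sup>2 = q powi (2 * a)" and "is_weight (shift i (- a) \<chi>)"
proof -
  obtain n k :: nat where p: "(\<chi> i)\<^sup>2 = q powi (2 * (int n - 2 * int k))"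
      "\<And>j. j \<le> n \<Longrightarrow> is_weight (shift i (int k - int j) \<chi>)"
    using weight_string[OF assms, of i Plus] by auto
  obtain n' k' :: nat where m: "(inverse (\<chi> i))\<^sup>2 = q powi (2 * (int n' - 2 * int k'))"
      "\<And>j. j \<le> n' \<Longrightarrow> is_weight (shift i (int j - int k') \<chi>)"
    using weight_string[OF assms, of i Minus] by (auto simp: power_int_minus)
  have "q powi (2 * (int n' - 2 * int k')) = inverse (q powi (2 * (int n - 2 * int k)))"
    using p(1) m(1) by (simp add: power_inverse)
  also have "\<dots> = q powi (- (2 * (int n - 2 * int k)))"
    by (simp only: power_int_minus)
  finally have e: "int n' - 2 * int k' = - (int n - 2 * int k)"
    unfolding q_powi_eq_iff by simp
  show ?thesis
  proof (rule that[OF p(1)])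
    show "is_weight (shift i (- (int n - 2 * int k)) \<chi>)"
    proof (cases "2 * k \<le> n")
      case True
      then show ?thesis using p(2)[of "n - k"] by (simp add: of_nat_diff algebra_simps)
    next
      case False
      then have "2 * k' \<le> n'" using e by linarith
      then have "is_weight (shift i (int n' - 2 * int k') \<chi>)"
        using m(2)[of "n' - k'"] by (simp add: of_nat_diff algebra_simps)
      then show ?thesis by (simp only: e)
    qed
  qed
qed

text \<open>
  Reflect at \<open>Node0\<close> and then at \<open>Node1\<close>.  The first reflection replaces \<open>b\<close> by \<open>b + 2 a\<close>, so
  the two together move \<open>\<chi>\<close> by \<open>- a + (b + 2 a) = a + b\<close> steps at \<open>Node0\<close>.
\<close>

lemma weight_translation:
  assumes "is_weight \<chi>" and a: "(\<chi> Node0)\<^sup>2 = q powi (2 * a)" and b: "(\<chi> Node1)\<^sup>2 = q powi (2 * b)"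
  shows "is_weight (shift Node0 (a + b) \<chi>)"
proof -
  obtain a' where a': "(\<chi> Node0)\<^sup>2 = q powi (2 * a')" "is_weight (shift Node0 (- a') \<chi>)"
    using weight_reflection[OF assms(1)] by blast
  have "a' = a" using a a'(1) by simp
  define \<psi> where "\<psi> = shift Node0 (- a) \<chi>"
  have \<psi>: "is_weight \<psi>" using a'(2) \<open>a' = a\<close> by (simp add: \<psi>_def)
  obtain c where c: "(\<psi> Node1)\<^sup>2 = q powi (2 * c)" "is_weight (shift Node1 (- c) \<psi>)"
    using weight_reflection[OF \<psi>] by blast
  have "(\<psi> Node1)\<^sup>2 = q powi (2 * b + 4 * a)"
    using b by (simp add: \<psi>_def shift_def)
  then have "c = b + 2 * a" using c(1) by simp
  moreover have "shift Node1 (- c) \<psi> = shift Node0 (c - a) \<chi>"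
  proof
    fix j show "shift Node1 (- c) \<psi> j = shift Node0 (c - a) \<chi> j"
      using \<open>c = b + 2 * a\<close> by (cases j) (simp_all add: \<psi>_def shift_def)
  qed
  ultimately show ?thesis using c(2) by simp
qed

text \<open>
  A shift by \<open>t\<close> replaces \<open>(a, b)\<close> by \<open>(a + 2 t, b - 2 t)\<close>, so the translation by \<open>a + b\<close> can be
  repeated; finiteness of the set of weights forces it to be trivial.  The conclusion says that
  the central element \<open>K\<^sub>0 K\<^sub>1\<close> acts on every weight vector by a square root of one.
\<close>

lemma weight_level_zero:
  assumes "is_weight \<chi>"
  obtains a where "(\<chi> Node0)\<^sup>2 = q powi (2 * a)" and "(\<chi> Node1)\<^sup>2 = q powi (2 * - a)"
proof -
  obtain a where a: "(\<chi> Node0)\<^sup>2 = q powi (2 * a)" using weight_reflection[OF assms] by blast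
  obtain b where b: "(\<chi> Node1)\<^sup>2 = q powi (2 * b)" using weight_reflection[OF assms] by blast
  have wt: "is_weight (shift Node0 (int n * (a + b)) \<chi>)" for n
  proof (induction n)
    case (Suc n)
    let ?t = "int n * (a + b)"
    have "(shift Node0 ?t \<chi> Node0)\<^sup>2 = q powi (2 * (a + 2 * ?t))"
      using a by (simp add: shift_def)
    moreover have "(shift Node0 ?t \<chi> Node1)\<^sup>2 = q powi (2 * (b - 2 * ?t))"
      using b by (simp add: shift_def)
    ultimately have "is_weight (shift Node0 (a + 2 * ?t + (b - 2 * ?t)) (shift Node0 ?t \<chi>))"
      by (rule weight_translation[OF Suc.IH])
    then show ?case by (simp add: shift_shift algebra_simps)
  qed (use assms in simp)
  have "a + b = 0"
  proof (rule ccontr)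
    assume "a + b \<noteq> 0"
    then have "inj (\<lambda>n::nat. shift Node0 (int n * (a + b)) \<chi>)"
      by (intro injI) (drule shift_inject[OF assms], simp)
    moreover have "finite (range (\<lambda>n::nat. shift Node0 (int n * (a + b)) \<chi>))"
      by (rule finite_subset[OF _ finitely_many_weights]) (use wt in auto)
    ultimately show False using finite_imageD by blast
  qed
  then have "b = - a" by simp
  then show ?thesis using that a b by blast
qed

section \<open>The classes of weights and the decomposition\<close>

definition weight_class :: "'k \<Rightarrow> 'k \<Rightarrow> parity \<Rightarrow> (node \<Rightarrow> 'k) set" where
  "weight_class \<epsilon>0 \<epsilon>1 \<sigma> = {\<chi>. \<exists>a. has_parity \<sigma> a \<and>
     \<chi> Node0 = \<epsilon>0 * q powi a \<and> \<chi> Node1 = \<epsilon>1 * q powi (- a)}"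

lemma square_eq_powi_square:
  assumes "x\<^sup>2 = q powi (2 * a)"
  obtains \<epsilon> where "\<epsilon> \<in> {1, - 1}" "x = \<epsilon> * q powi a"
proof -
  have "x\<^sup>2 = (q powi a)\<^sup>2" using assms q_powi_square[of 1 a] by simp
  then have "x = 1 * q powi a \<or> x = - 1 * q powi a" by (simp add: power2_eq_iff)
  then show ?thesis using that by blast
qed

lemma weight_in_some_class:
  assumes "is_weight \<chi>"
  shows "\<exists>\<epsilon>0\<in>{1, - 1}. \<exists>\<epsilon>1\<in>{1, - 1}. \<exists>\<sigma>. \<chi> \<in> weight_class \<epsilon>0 \<epsilon>1 \<sigma>"
proof -
  obtain a where a: "(\<chi> Node0)\<^sup>2 = q powi (2 * a)" "(\<chi> Node1)\<^sup>2 = q powi (2 * - a)"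
    using weight_level_zero[OF assms] .
  obtain \<epsilon>0 where 0: "\<epsilon>0 \<in> {1, - 1}" "\<chi> Node0 = \<epsilon>0 * q powi a"
    using square_eq_powi_square[OF a(1)] .
  obtain \<epsilon>1 where 1: "\<epsilon>1 \<in> {1, - 1}" "\<chi> Node1 = \<epsilon>1 * q powi (- a)"
    using square_eq_powi_square[OF a(2)] .
  have "has_parity (if even a then Even_part else Odd_part) a" by simp
  then have "\<chi> \<in> weight_class \<epsilon>0 \<epsilon>1 (if even a then Even_part else Odd_part)"
    unfolding weight_class_def using 0(2) 1(2) by blast
  then show ?thesis using 0(1) 1(1) by blast
qed

text \<open>
  Squaring removes the signs, so \<open>q\<^sup>2\<^sup>a\<close> and with it \<open>a\<close> is determined by the weight.  In
  characteristic two both signs are equal, and the set of signs is a singleton.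
\<close>

lemma weight_class_unique:
  assumes signs: "\<epsilon>0 \<in> {1, - 1}" "\<epsilon>1 \<in> {1, - 1}" "\<delta>0 \<in> {1, - 1}" "\<delta>1 \<in> {1, - 1}"
    and "\<chi> \<in> weight_class \<epsilon>0 \<epsilon>1 \<sigma>" "\<chi> \<in> weight_class \<delta>0 \<delta>1 \<tau>"
  shows "\<epsilon>0 = \<delta>0 \<and> \<epsilon>1 = \<delta>1 \<and> \<sigma> = \<tau>"
proof -
  obtain a where a: "has_parity \<sigma> a" "\<chi> Node0 = \<epsilon>0 * q powi a" "\<chi> Node1 = \<epsilon>1 * q powi (- a)"
    using assms(5) unfolding weight_class_def by blast
  obtain b where b: "has_parity \<tau> b" "\<chi> Node0 = \<delta>0 * q powi b" "\<chi> Node1 = \<delta>1 * q powi (- b)"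
    using assms(6) unfolding weight_class_def by blast
  have "\<epsilon>0\<^sup>2 = 1" "\<delta>0\<^sup>2 = 1" using signs by auto
  then have "q powi (2 * a) = q powi (2 * b)"
    using q_powi_square[of \<epsilon>0 a] q_powi_square[of \<delta>0 b] a(2) b(2) by (metis mult_1)
  then have "a = b" by simp
  moreover have "\<sigma> = \<tau>" using a(1) b(1) \<open>a = b\<close> by (cases \<sigma>; cases \<tau>) auto
  moreover have "\<epsilon>0 = \<delta>0" using a(2) b(2) \<open>a = b\<close> q_nonzero by simp
  moreover have "\<epsilon>1 = \<delta>1" using a(3) b(3) \<open>a = b\<close> q_nonzero by simp
  ultimately show ?thesis by blast
qed

lemma shift_weight_class:
  assumes "\<chi> \<in> weight_class \<epsilon>0 \<epsilon>1 \<sigma>"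
  shows "shift i t \<chi> \<in> weight_class \<epsilon>0 \<epsilon>1 \<sigma>"
proof -
  obtain a where a: "has_parity \<sigma> a" "\<chi> Node0 = \<epsilon>0 * q powi a" "\<chi> Node1 = \<epsilon>1 * q powi (- a)"
    using assms unfolding weight_class_def by blast
  let ?b = "a + (if i = Node0 then 2 else - 2) * t"
  have "has_parity \<sigma> ?b" using a(1) by (cases \<sigma>) auto
  moreover have "shift i t \<chi> Node0 = \<epsilon>0 * q powi ?b" "shift i t \<chi> Node1 = \<epsilon>1 * q powi (- ?b)"
    using a(2,3) by (cases i; simp add: shift_def)+
  ultimately show ?thesis unfolding weight_class_def by blast
qed

lemma V_part_eq_span_weight_class:
  "V_part scale q act \<epsilon>0 \<epsilon>1 \<sigma> = span {v. \<exists>\<chi>\<in>weight_class \<epsilon>0 \<epsilon>1 \<sigma>. weight_vector \<chi> v}"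
proof -
  have "(\<exists>\<chi>\<in>weight_class \<epsilon>0 \<epsilon>1 \<sigma>. weight_vector \<chi> v) \<longleftrightarrow>
      (\<exists>a. has_parity \<sigma> a \<and> K Node0 v = scale (\<epsilon>0 * q powi a) v \<and>
        K Node1 v = scale (\<epsilon>1 * q powi (- a)) v)" (is "?L \<longleftrightarrow> ?R") for v
  proof
    assume ?L
    then obtain \<chi> a where "weight_vector \<chi> v" "has_parity \<sigma> a"
      "\<chi> Node0 = \<epsilon>0 * q powi a" "\<chi> Node1 = \<epsilon>1 * q powi (- a)"
      unfolding weight_class_def by blast
    then have "has_parity \<sigma> a \<and> K Node0 v = scale (\<epsilon>0 * q powi a) v \<and>
        K Node1 v = scale (\<epsilon>1 * q powi (- a)) v"
      by (simp add: weight_vector_def)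
    then show ?R ..
  next
    assume ?R
    then obtain a where a: "has_parity \<sigma> a" "K Node0 v = scale (\<epsilon>0 * q powi a) v"
      "K Node1 v = scale (\<epsilon>1 * q powi (- a)) v" by blast
    let ?\<chi> = "case_node (\<epsilon>0 * q powi a) (\<epsilon>1 * q powi (- a))"
    have "weight_vector ?\<chi> v"
      unfolding weight_vector_def using a(2,3) by (auto split: node.split)
    moreover have "?\<chi> \<in> weight_class \<epsilon>0 \<epsilon>1 \<sigma>"
      unfolding weight_class_def using a(1) by auto
    ultimately show ?L by blast
  qed
  then show ?thesis by (simp add: V_part_def rep_def)
qed

lemma V_part_submodule: "Uq_submodule scale q act (V_part scale q act \<epsilon>0 \<epsilon>1 \<sigma>)"
proof (rule Uq_submodule_if_generators_closed)
  let ?S = "{v. \<exists>\<chi>\<in>weight_class \<epsilon>0 \<epsilon>1 \<sigma>. weight_vector \<chi> v}"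
  show "subspace (V_part scale q act \<epsilon>0 \<epsilon>1 \<sigma>)"
    by (simp add: V_part_eq_span_weight_class)
  fix x w assume "w \<in> V_part scale q act \<epsilon>0 \<epsilon>1 \<sigma>"
  then have "w \<in> span ?S" by (simp add: V_part_eq_span_weight_class)
  then have "rep (gen x) w \<in> span ?S"
  proof (induction rule: span_induct)
    case base
    show ?case
      by (auto simp: subspace_def rep_add_right rep_scale span_add span_scale span_zero)
  next
    case (step v)
    then obtain \<chi> where \<chi>: "\<chi> \<in> weight_class \<epsilon>0 \<epsilon>1 \<sigma>" "weight_vector \<chi> v" by blast
    show ?case
    proof (cases x)
      case (Chev_E i s)
      then show ?thesis
        using weight_vector_E[OF \<chi>(2)] shift_weight_class[OF \<chi>(1)] by (blast intro: span_base)
    next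
      case (Chev_K i)
      then show ?thesis using \<chi> step by (simp add: weight_vector_def span_scale span_base)
    next
      case (Chev_Kinv i)
      then show ?thesis using \<chi> step by (simp add: Kinv_weight_vector span_scale span_base)
    qed
  qed
  then show "rep (gen x) w \<in> V_part scale q act \<epsilon>0 \<epsilon>1 \<sigma>"
    by (simp add: V_part_eq_span_weight_class)
qed

text \<open>
  Indexing the components by all weights, rather than by those in \<open>C\<close>, allows decompositions for
  different sets \<open>C\<close> to be added.
\<close>

lemma span_weight_vectors_decompose:
  assumes "v \<in> span {v. \<exists>\<chi>\<in>C. weight_vector \<chi> v}"
  obtains h where "\<And>\<chi>. weight_vector \<chi> (h \<chi>)" "\<And>\<chi>. \<chi> \<notin> C \<Longrightarrow> h \<chi> = 0"
    "v = (\<Sum>\<chi> | is_weight \<chi>. h \<chi>)"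
proof -
  let ?P = "\<lambda>v. \<exists>h. (\<forall>\<chi>. weight_vector \<chi> (h \<chi>)) \<and> (\<forall>\<chi>. \<chi> \<notin> C \<longrightarrow> h \<chi> = 0) \<and>
    v = (\<Sum>\<chi> | is_weight \<chi>. h \<chi>)"
  from assms have "?P v"
  proof (induction rule: span_induct)
    case base
    show ?case
    proof (rule subspaceI)
      show "0 \<in> {v. ?P v}"
        by (intro CollectI exI[of _ "\<lambda>_. 0"]) (simp add: weight_vector_zero)
    next
      fix x y assume "x \<in> {v. ?P v}" "y \<in> {v. ?P v}"
      then obtain g h where "\<forall>\<chi>. weight_vector \<chi> (g \<chi>)" "\<forall>\<chi>. \<chi> \<notin> C \<longrightarrow> g \<chi> = 0"
        "x = (\<Sum>\<chi> | is_weight \<chi>. g \<chi>)" "\<forall>\<chi>. weight_vector \<chi> (h \<chi>)" "\<forall>\<chi>. \<chi> \<notin> C \<longrightarrow> h \<chi> = 0"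
        "y = (\<Sum>\<chi> | is_weight \<chi>. h \<chi>)"
        by auto
      then show "x + y \<in> {v. ?P v}"
        by (intro CollectI exI[of _ "\<lambda>\<chi>. g \<chi> + h \<chi>"]) (simp add: weight_vector_add sum.distrib)
    next
      fix c x assume "x \<in> {v. ?P v}"
      then obtain g where "\<forall>\<chi>. weight_vector \<chi> (g \<chi>)" "\<forall>\<chi>. \<chi> \<notin> C \<longrightarrow> g \<chi> = 0"
        "x = (\<Sum>\<chi> | is_weight \<chi>. g \<chi>)"
        by auto
      then show "scale c x \<in> {v. ?P v}"
        by (intro CollectI exI[of _ "\<lambda>\<chi>. scale c (g \<chi>)"])
          (simp add: weight_vector_scale scale_sum_right)
    qed
  next
    case (step v)
    then obtain \<chi> where \<chi>: "\<chi> \<in> C" "weight_vector \<chi> v" by blast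
    let ?h = "\<lambda>\<psi>. if \<psi> = \<chi> then v else 0"
    have "v = (\<Sum>\<psi> | is_weight \<psi>. ?h \<psi>)"
      using \<chi>(2) finitely_many_weights by (cases "v = 0") (auto simp: is_weight_def)
    then show ?case
      using \<chi> by (intro exI[of _ ?h]) (auto simp: weight_vector_zero)
  qed
  then show ?thesis using that by blast
qed

lemma weight_partition_direct_sum:
  assumes "finite I"
    and cover: "\<And>\<chi>. is_weight \<chi> \<Longrightarrow> \<exists>i\<in>I. \<chi> \<in> C i"
    and disj: "\<And>\<chi> i j. i \<in> I \<Longrightarrow> j \<in> I \<Longrightarrow> \<chi> \<in> C i \<Longrightarrow> \<chi> \<in> C j \<Longrightarrow> i = j"
    and spanning: "span {v. \<exists>\<chi>. weight_vector \<chi> v} = UNIV"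
  shows "\<exists>!f. f \<in> (\<Pi>\<^sub>E i\<in>I. span {v. \<exists>\<chi>\<in>C i. weight_vector \<chi> v}) \<and> v = (\<Sum>i\<in>I. f i)"
    (is "\<exists>!f. f \<in> (\<Pi>\<^sub>E i\<in>I. ?S i) \<and> _")
proof (rule ex_ex1I)
  have "v \<in> span {v. \<exists>\<chi>\<in>UNIV. weight_vector \<chi> v}" using spanning by simp
  then obtain h where h: "\<And>\<chi>. weight_vector \<chi> (h \<chi>)" "v = (\<Sum>\<chi> | is_weight \<chi>. h \<chi>)"
    by (rule span_weight_vectors_decompose) blast
  \<comment> \<open>Collect the weight components of \<open>v\<close> according to the class of their weight.\<close>
  obtain cls where cls: "\<And>\<chi>. is_weight \<chi> \<Longrightarrow> cls \<chi> \<in> I \<and> \<chi> \<in> C (cls \<chi>)"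
    using that[of "\<lambda>\<chi>. SOME i. i \<in> I \<and> \<chi> \<in> C i"] cover by (metis (mono_tags, lifting) someI_ex)
  let ?f = "restrict (\<lambda>i. \<Sum>\<chi> | \<chi> \<in> {\<chi>. is_weight \<chi>} \<and> cls \<chi> = i. h \<chi>) I"
  have "(\<Sum>\<chi> | \<chi> \<in> {\<chi>. is_weight \<chi>} \<and> cls \<chi> = i. h \<chi>) \<in> ?S i" for i
    by (intro span_sum span_base) (use cls h(1) in blast)
  then have "?f i \<in> ?S i" if "i \<in> I" for i
    using that by simp
  moreover have "cls ` {\<chi>. is_weight \<chi>} \<subseteq> I" using cls by auto
  then have "v = (\<Sum>i\<in>I. ?f i)"
    using sum.group[OF finitely_many_weights \<open>finite I\<close>, of cls h] h(2) by simp
  ultimately show "\<exists>f. f \<in> (\<Pi>\<^sub>E i\<in>I. ?S i) \<and> v = (\<Sum>i\<in>I. f i)"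
    by (intro exI[of _ ?f]) auto
next
  fix f g
  assume f: "f \<in> (\<Pi>\<^sub>E i\<in>I. ?S i) \<and> v = (\<Sum>i\<in>I. f i)"
    and g: "g \<in> (\<Pi>\<^sub>E i\<in>I. ?S i) \<and> v = (\<Sum>i\<in>I. g i)"
  have "\<exists>h. (\<forall>\<chi>. weight_vector \<chi> (h \<chi>)) \<and> (\<forall>\<chi>. \<chi> \<notin> C i \<longrightarrow> h \<chi> = 0) \<and>
      f i - g i = (\<Sum>\<chi> | is_weight \<chi>. h \<chi>)" if "i \<in> I" for i
  proof -
    have "f i - g i \<in> ?S i" using f g that by (auto intro!: span_diff)
    then show ?thesis by (rule span_weight_vectors_decompose) blast
  qed
  then obtain h where h: "\<And>i \<chi>. i \<in> I \<Longrightarrow> weight_vector \<chi> (h i \<chi>)"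
      "\<And>i \<chi>. i \<in> I \<Longrightarrow> \<chi> \<notin> C i \<Longrightarrow> h i \<chi> = 0"
      "\<And>i. i \<in> I \<Longrightarrow> f i - g i = (\<Sum>\<chi> | is_weight \<chi>. h i \<chi>)"
    by metis
  \<comment> \<open>For each \<open>\<chi>\<close>, at most one of the \<open>h i \<chi>\<close> is nonzero, as the classes are disjoint.\<close>
  have "(\<Sum>\<chi> | is_weight \<chi>. \<Sum>i\<in>I. h i \<chi>) = (\<Sum>i\<in>I. f i - g i)"
    by (subst sum.swap) (simp add: h(3))
  also have "\<dots> = 0" using f g by (simp add: sum_subtractf)
  finally have total: "(\<Sum>\<chi> | is_weight \<chi>. \<Sum>i\<in>I. h i \<chi>) = 0" .
  have "h i \<chi> = 0" if "i \<in> I" "is_weight \<chi>" for i \<chi>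
  proof (cases "\<chi> \<in> C i")
    case True
    have "(\<Sum>j\<in>I. h j \<chi>) = 0"
      by (rule weight_vectors_sum_eq_0[OF finitely_many_weights _ total])
        (use that h(1) in \<open>auto intro: weight_vector_sum\<close>)
    moreover have "h j \<chi> = 0" if "j \<in> I - {i}" for j
      using disj[of j i \<chi>] h(2)[of j \<chi>] that \<open>i \<in> I\<close> True by blast
    then have "(\<Sum>j\<in>I. h j \<chi>) = h i \<chi>"
      using \<open>finite I\<close> \<open>i \<in> I\<close> by (simp add: sum.remove)
    ultimately show ?thesis by simp
  qed (use that h(2) in blast)
  then have "f i = g i" if "i \<in> I" for i using h(3)[OF that] that by simp
  then show "f = g" using f g by (metis (no_types, lifting) PiE_ext)
qed

end

theorem theorem11p2:
  fixes q :: "'k::alg_closed_field"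
    and scale :: "'k \<Rightarrow> 'v::ab_group_add \<Rightarrow> 'v"
    and act :: "'k free_alg set \<Rightarrow> 'v \<Rightarrow> 'v"
  assumes "q \<noteq> 0"
    and "\<forall>n::nat. n > 0 \<longrightarrow> q ^ n \<noteq> 1"
    and "Uq_module scale q act"
    and "\<exists>B. finite_dimensional_vector_space scale B"
    and "\<exists>v::'v. v \<noteq> 0"
    and "diagonalizable_endo scale (act (Uq_K q Node0))"
    and "diagonalizable_endo scale (act (Uq_K q Node1))"
  shows "direct_sum_of_submodules scale q act
           ({1, -1} \<times> {1, -1} \<times> {Even_part, Odd_part})
           (\<lambda>(\<epsilon>0, \<epsilon>1, \<sigma>). V_part scale q act \<epsilon>0 \<epsilon>1 \<sigma>)"
proof -
  interpret Uq_module scale q act by fact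
  interpret finite_dimensional_generic_Uq_module scale q act
    using assms(1,2,4) by unfold_locales auto
  let ?I = "{1, - 1 :: 'k} \<times> {1, - 1 :: 'k} \<times> {Even_part, Odd_part}"
  let ?C = "\<lambda>(\<epsilon>0, \<epsilon>1, \<sigma>). weight_class \<epsilon>0 \<epsilon>1 \<sigma>"
  have "diagonalizable_endo scale (K i)" for i
    using assms(6,7) by (cases i) (simp_all add: rep_def)
  then have spanning: "span {v. \<exists>\<chi>. weight_vector \<chi> v} = UNIV"
    by (rule span_weight_vectors)
  have "\<exists>!f. f \<in> (\<Pi>\<^sub>E i\<in>?I. span {v. \<exists>\<chi>\<in>?C i. weight_vector \<chi> v}) \<and> v = (\<Sum>i\<in>?I. f i)" for v
  proof (rule weight_partition_direct_sum[OF _ _ _ spanning])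
    fix \<chi> assume "is_weight \<chi>"
    then obtain \<epsilon>0 \<epsilon>1 \<sigma> where "\<epsilon>0 \<in> {1, - 1}" "\<epsilon>1 \<in> {1, - 1}" "\<chi> \<in> weight_class \<epsilon>0 \<epsilon>1 \<sigma>"
      using weight_in_some_class by blast
    then show "\<exists>i\<in>?I. \<chi> \<in> ?C i"
      by (intro bexI[of _ "(\<epsilon>0, \<epsilon>1, \<sigma>)"]) (cases \<sigma>; auto)+
  next
    fix \<chi> i j assume "i \<in> ?I" "j \<in> ?I" "\<chi> \<in> ?C i" "\<chi> \<in> ?C j"
    then show "i = j"
      by (cases i; cases j) (use weight_class_unique in \<open>force simp del: insert_iff\<close>)
  qed simp
  moreover have W: "(\<lambda>(\<epsilon>0, \<epsilon>1, \<sigma>). V_part scale q act \<epsilon>0 \<epsilon>1 \<sigma>)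
      = (\<lambda>i. span {v. \<exists>\<chi>\<in>?C i. weight_vector \<chi> v})"
    by (auto simp: fun_eq_iff V_part_eq_span_weight_class)
  moreover have "Uq_submodule scale q act (span {v. \<exists>\<chi>\<in>?C i. weight_vector \<chi> v})" for i
    using V_part_submodule by (cases i) (simp add: V_part_eq_span_weight_class)
  moreover have "finite ?I" by simp
  ultimately show ?thesis
    unfolding direct_sum_of_submodules_def by (simp only: W) blast
qed

end
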